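(* Let $\mathbb{V}$ be a finite dimensional vector space over a finite field $\mathbb{F}$, with $\dim(\mathbb{V})\ge 1$, and let $\mathbb{IG(V)}$ and $\mathbb{UG(V)}$ be its skeleton intersection graph and skeleton union graph with respect to a basis $\mathcal{B}$. Then: (1) $\mathbb{IG(V)}$ is chordal if and only if $\dim(\mathbb{V})\le 3$. (2) $\mathbb{UG(V)}$ is chordal if and only if either $\dim(\mathbb{V})=1$, or $\dim(\mathbb{V})\in\{2,3\}$ and $|\mathbb{F}|=2$. (3) $\mathbb{IG(V)}$ is perfect if and only if $\mathbb{UG(V)}$ is perfect, and this occurs if and only if $\dim(\mathbb{V})\le 4$.
   Context: All graphs are simple. Let $\mathcal{B}=\{v_1,\dots,v_n\}$ be a basis of $\mathbb{V}$. For $a=a_1v_1+\dots+a_nv_n\in\mathbb{V}$, let $S_{\mathcal{B}}(a)=\{v_i\mid a_i\neq 0\}$. The skeleton intersection graph (nonzero component graph) $\mathbb{IG(V)}$ has vertex set $\mathbb{V}\setminus\{0\}$, with distinct $a,b$ adjacent iff $S_{\mathcal{B}}(a)\cap S_{\mathcal{B}}(b)\neq\emptyset$. The skeleton union graph (nonzero component union graph) $\mathbb{UG(V)}$ has vertex set $\mathbb{V}\setminus\{0\}$, with distinct $a,b$ adjacent iff $S_{\mathcal{B}}(a)\cup S_{\mathcal{B}}(b)=\mathcal{B}$. Up to isomorphism these graphs do not depend on the choice of basis. A graph is chordal if it contains no induced cycle of length at least $4$. A graph is perfect if the chromatic number of every induced subgraph equals the clique number of that subgraph. *)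

theory Defs
  imports Complex_Main "HOL-Library.Ramsey"
begin

text \<open>
  A graph is a pair of a vertex set and a set of edges, an edge being the two-element set of its
  ends (the edge-set convention of \<^const>\<open>clique\<close>).
\<close>

type_synonym 'a sgraph = "'a set \<times> 'a set set"

definition simple_graph :: "'a sgraph \<Rightarrow> bool" where
  "simple_graph G \<longleftrightarrow> (\<forall>e \<in> snd G. e \<subseteq> fst G \<and> card e = 2)"

definition induced :: "'a sgraph \<Rightarrow> 'a set \<Rightarrow> 'a sgraph" where
  "induced G W = (W, {e \<in> snd G. e \<subseteq> W})"

definition cycle_edges :: "'a list \<Rightarrow> 'a set set" where
  "cycle_edges xs = {{xs ! i, xs ! ((i + 1) mod length xs)} | i. i < length xs}"

definition induced_cycle :: "'a sgraph \<Rightarrow> 'a list \<Rightarrow> bool" where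
  "induced_cycle G xs \<longleftrightarrow>
     3 \<le> length xs \<and> distinct xs \<and> set xs \<subseteq> fst G \<and>
     induced G (set xs) = (set xs, cycle_edges xs)"

definition chordal :: "'a sgraph \<Rightarrow> bool" where
  "chordal G \<longleftrightarrow> (\<nexists>xs. induced_cycle G xs \<and> 4 \<le> length xs)"

definition proper_colouring :: "'a sgraph \<Rightarrow> nat \<Rightarrow> ('a \<Rightarrow> nat) \<Rightarrow> bool" where
  "proper_colouring G k c \<longleftrightarrow>
     (\<forall>v \<in> fst G. c v < k) \<and>
     (\<forall>u \<in> fst G. \<forall>v \<in> fst G. {u, v} \<in> snd G \<longrightarrow> c u \<noteq> c v)"

text \<open>
  The following two numbers are meaningful for finite simple graphs only; this suffices, since a
  finite-dimensional space over a finite field is finite.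
\<close>

definition chromatic_number :: "'a sgraph \<Rightarrow> nat" where
  "chromatic_number G = (LEAST k. \<exists>c. proper_colouring G k c)"

definition clique_number :: "'a sgraph \<Rightarrow> nat" where
  "clique_number G = Max (card ` {K. K \<subseteq> fst G \<and> clique K (snd G)})"

definition perfect :: "'a sgraph \<Rightarrow> bool" where
  "perfect G \<longleftrightarrow>
     (\<forall>W \<subseteq> fst G. chromatic_number (induced G W) = clique_number (induced G W))"

definition skeleton :: "('f::field \<Rightarrow> 'v::ab_group_add \<Rightarrow> 'v) \<Rightarrow> 'v set \<Rightarrow> 'v \<Rightarrow> 'v set" where
  "skeleton scale B a = {v \<in> B. module.representation scale B a v \<noteq> 0}"

definition IG :: "('f::field \<Rightarrow> 'v::ab_group_add \<Rightarrow> 'v) \<Rightarrow> 'v set \<Rightarrow> 'v sgraph" where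
  "IG scale B = (UNIV - {0},
     {{a, b} | a b. a \<noteq> 0 \<and> b \<noteq> 0 \<and> a \<noteq> b \<and> skeleton scale B a \<inter> skeleton scale B b \<noteq> {}})"

definition UG :: "('f::field \<Rightarrow> 'v::ab_group_add \<Rightarrow> 'v) \<Rightarrow> 'v set \<Rightarrow> 'v sgraph" where
  "UG scale B = (UNIV - {0},
     {{a, b} | a b. a \<noteq> 0 \<and> b \<noteq> 0 \<and> a \<noteq> b \<and> skeleton scale B a \<union> skeleton scale B b = B})"

lemma simple_graph_IG: "simple_graph (IG scale B)"
  by (auto simp: simple_graph_def IG_def)

lemma simple_graph_UG: "simple_graph (UG scale B)"
  by (auto simp: simple_graph_def UG_def)

end

theory Submission
  imports Defs
begin

text \<open>
  Vertices are governed by their labels. In the intersection graph two vectors are adjacent iff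
  their skeletons meet; in the union graph they are adjacent iff their coskeletons (complements of
  the skeletons in the basis) are disjoint.

  Chordality. In an induced cycle of length at least 4 the neighbours of a vertex are not adjacent.
  For the intersection graph this gives two non-adjacent vertices with disjoint skeletons of size
  at least 2, so the dimension is at least 4. For the union graph over the two-element field labels
  determine vectors, and for dimension at most 3 two non-adjacent vertices would have meeting
  coskeletons of size at most 1, hence would be equal.

  Perfection. In dimension at least 5 the labels \<open>{b\<^sub>i, b\<^sub>i\<^sub>+\<^sub>1}\<close>, indices modulo 5, give an induced
  5-cycle. In dimension at most 4, a family of nonempty sets is covered by as many intersecting
  families as it has pairwise disjoint members: take one star for each singleton in the family; the
  sets missed have size at least 2 and avoid the singletons, so they meet pairwise as soon as there
  is a singleton; if there is none, one star and the sets outside it suffice. Hence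
  graphs of disjointness of labels, in particular the union graph, are perfect. The intersection
  graph is the complement of such a graph, and Lovasz' theorem applies.
\<close>

section \<open>Perfection and covers by independent sets\<close>

text \<open>This is \<open>k\<close>-colourability of the subgraph on \<open>W\<close>. Covers by at
  most \<open>k\<close> sets, which may overlap and leave \<open>W\<close>, replace colourings
  because they restrict to subsets and join under unions.\<close>

definition indep_cover :: "'a set set \<Rightarrow> 'a set \<Rightarrow> nat \<Rightarrow> bool" where
  "indep_cover E W k \<longleftrightarrow>
     (\<exists>C. finite C \<and> card C \<le> k \<and> W \<subseteq> \<Union>C \<and> (\<forall>X \<in> C. indep X E))"

text \<open>For finite \<open>W\<close>, a certificate that chromatic and clique number agree: a
  clique and a colouring of equal size prove each other optimal.\<close>

definition clique_colourable :: "'a set set \<Rightarrow> 'a set \<Rightarrow> bool" where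
  "clique_colourable E W \<longleftrightarrow> (\<exists>K \<subseteq> W. clique K E \<and> indep_cover E W (card K))"

definition clique_perfect :: "'a set set \<Rightarrow> 'a set \<Rightarrow> bool" where
  "clique_perfect E V \<longleftrightarrow> (\<forall>W \<subseteq> V. clique_colourable E W)"

text \<open>The set complement \<open>- E\<close> serves as the complement graph. It also contains
  singletons and sets that are not pairs, but \<open>clique\<close> and \<open>indep\<close> look
  only at pairs of distinct vertices.\<close>

lemma clique_uminus: "clique K (- E) \<longleftrightarrow> indep K E"
  and indep_uminus: "indep K (- E) \<longleftrightarrow> clique K E"
  by (auto simp: clique_def indep_def)

lemma indep_coverI:
  "finite C \<Longrightarrow> card C \<le> k \<Longrightarrow> W \<subseteq> \<Union>C \<Longrightarrow> (\<And>X. X \<in> C \<Longrightarrow> indep X E) \<Longrightarrow> indep_cover E W k"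
  unfolding indep_cover_def by blast

lemma indep_cover_mono:
  assumes "indep_cover E W k" "W' \<subseteq> W" "k \<le> k'"
  shows "indep_cover E W' k'"
  using assms unfolding indep_cover_def by (meson order_trans)

lemma indep_cover_Un:
  assumes "indep_cover E W k" "indep_cover E W' k'"
  shows "indep_cover E (W \<union> W') (k + k')"
proof -
  obtain C C' where C: "finite C" "card C \<le> k" "W \<subseteq> \<Union>C" "\<forall>X \<in> C. indep X E"
    and C': "finite C'" "card C' \<le> k'" "W' \<subseteq> \<Union>C'" "\<forall>X \<in> C'. indep X E"
    using assms unfolding indep_cover_def by blast
  have "card (C \<union> C') \<le> k + k'"
    using card_Un_le[of C C'] C(2) C'(2) by linarith
  then show ?thesis
    using C C' by (intro indep_coverI[of "C \<union> C'"]) auto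
qed

lemma indep_cover_indep: "indep X E \<Longrightarrow> indep_cover E X 1"
  by (rule indep_coverI[of "{X}"]) auto

lemma indep_cover_card: "finite W \<Longrightarrow> indep_cover E W (card W)"
  by (rule indep_coverI[of "(\<lambda>v. {v}) ` W"]) (auto simp: indep_def card_image_le)

text \<open>Each member of the cover meets \<open>W\<close> in an independent set, hence in at most
  \<open>m\<close> vertices. The bound serves for cliques, for five-cycles and for the blow-up in
  the perfect graph theorem.\<close>

lemma card_le_indep_cover_mult:
  assumes "finite W" "indep_cover E W k" and m: "\<And>X. X \<subseteq> W \<Longrightarrow> indep X E \<Longrightarrow> card X \<le> m"
  shows "card W \<le> k * m"
proof -
  obtain C where C: "finite C" "card C \<le> k" "W \<subseteq> \<Union>C" "\<forall>X \<in> C. indep X E"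
    using assms(2) unfolding indep_cover_def by blast
  have "W = (\<Union>X \<in> C. W \<inter> X)"
    using C(3) by blast
  then have "card W \<le> (\<Sum>X \<in> C. card (W \<inter> X))"
    using card_UN_le[OF C(1)] by metis
  also have "\<dots> \<le> (\<Sum>X \<in> C. m)"
    using C(4) by (intro sum_mono m) (auto simp: indep_def)
  also have "\<dots> \<le> k * m"
    using C(2) by simp
  finally show ?thesis .
qed

text \<open>A clique shares at most one vertex with an independent set, so the counting bound
  applies with \<open>m = 1\<close>.\<close>

lemma card_clique_le_indep_cover:
  assumes "finite K" "K \<subseteq> W" "clique K E" "indep_cover E W k"
  shows "card K \<le> k"
proof -
  have "card X \<le> 1" if "X \<subseteq> K" "indep X E" for X
    using that assms(1,3) finite_subset[OF that(1)]
    by (auto simp: clique_def indep_def card_le_Suc0_iff_eq subset_iff)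
  then show ?thesis
    using card_le_indep_cover_mult[of K E k 1] assms indep_cover_mono[of E W k K k] by simp
qed

text \<open>Colour classes are independent; conversely, number the members of a cover and colour
  each vertex by a member containing it. Loops are excluded because \<open>proper_colouring\<close>
  also tests \<open>u = v\<close>, while \<open>indep\<close> does not.\<close>

lemma proper_colouring_iff_indep_cover:
  assumes "\<And>v. v \<in> W \<Longrightarrow> {v} \<notin> E"
  shows "(\<exists>c. proper_colouring (induced (V, E) W) k c) \<longleftrightarrow> indep_cover E W k"
proof
  assume "\<exists>c. proper_colouring (induced (V, E) W) k c"
  then obtain c where c: "\<And>v. v \<in> W \<Longrightarrow> c v < k"
    "\<And>u v. u \<in> W \<Longrightarrow> v \<in> W \<Longrightarrow> {u, v} \<in> E \<Longrightarrow> c u \<noteq> c v"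
    unfolding proper_colouring_def induced_def by auto
  show "indep_cover E W k"
  proof (rule indep_coverI[of "(\<lambda>i. {v \<in> W. c v = i}) ` {..<k}"])
    show "card ((\<lambda>i. {v \<in> W. c v = i}) ` {..<k}) \<le> k"
      using card_image_le[of "{..<k}"] by (metis card_lessThan finite_lessThan)
    show "indep X E" if "X \<in> (\<lambda>i. {v \<in> W. c v = i}) ` {..<k}" for X
      using that c(2) by (fastforce simp: indep_def)
  qed (use c(1) in auto)
next
  assume "indep_cover E W k"
  then obtain C where C: "finite C" "card C \<le> k" "W \<subseteq> \<Union>C" "\<forall>X \<in> C. indep X E"
    unfolding indep_cover_def by blast
  obtain h where h: "bij_betw h C {0..<card C}"
    using ex_bij_betw_finite_nat[OF C(1)] by blast
  have "\<forall>v \<in> W. \<exists>X \<in> C. v \<in> X"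
    using C(3) by blast
  then obtain s where s: "\<And>v. v \<in> W \<Longrightarrow> s v \<in> C" "\<And>v. v \<in> W \<Longrightarrow> v \<in> s v"
    by metis
  have "proper_colouring (induced (V, E) W) k (h \<circ> s)"
    unfolding proper_colouring_def induced_def fst_conv snd_conv comp_def
  proof (intro conjI ballI impI)
    fix v assume "v \<in> W"
    then have "h (s v) \<in> {0..<card C}"
      using s(1) h by (meson bij_betw_apply)
    then show "h (s v) < k"
      using C(2) by simp
  next
    fix u v assume uv: "u \<in> W" "v \<in> W" "{u, v} \<in> {e \<in> E. e \<subseteq> W}"
    show "h (s u) \<noteq> h (s v)"
    proof
      assume "h (s u) = h (s v)"
      then have "s u = s v"
        using h s(1) uv(1,2) by (metis bij_betw_inv_into_left)
      then have "u \<in> s u" "v \<in> s u" "indep (s u) E"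
        using s uv(1,2) C(4) by auto
      then have "u = v"
        using uv(3) unfolding indep_def by blast
      then show False
        using uv assms by auto
    qed
  qed
  then show "\<exists>c. proper_colouring (induced (V, E) W) k c"
    by blast
qed

text \<open>A maximum clique gives \<omega> \<le> \<chi>, and a clique with a cover of its own size
  squeezes the two together.\<close>

lemma chromatic_eq_clique_number_iff:
  assumes "finite W" "\<And>v. v \<in> W \<Longrightarrow> {v} \<notin> E"
  shows "chromatic_number (induced (V, E) W) = clique_number (induced (V, E) W)
    \<longleftrightarrow> clique_colourable E W"
proof -
  define \<chi> where "\<chi> = chromatic_number (induced (V, E) W)"
  define \<omega> where "\<omega> = clique_number (induced (V, E) W)"
  have \<chi>_Least: "\<chi> = (LEAST k. indep_cover E W k)"
    unfolding \<chi>_def chromatic_number_def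
    using proper_colouring_iff_indep_cover[of W E V, OF assms(2)] by simp
  then have \<chi>: "indep_cover E W \<chi>" "\<And>k. indep_cover E W k \<Longrightarrow> \<chi> \<le> k"
    using indep_cover_card[OF assms(1)] by (auto intro: LeastI Least_le)
  have cliques: "{K. K \<subseteq> fst (induced (V, E) W) \<and> clique K (snd (induced (V, E) W))}
      = {K. K \<subseteq> W \<and> clique K E}"
    by (auto simp: induced_def clique_def)
  have fin: "finite {K. K \<subseteq> W \<and> clique K E}"
    using assms(1) by simp
  have \<omega>_Max: "\<omega> = Max (card ` {K. K \<subseteq> W \<and> clique K E})"
    unfolding \<omega>_def clique_number_def cliques ..
  \<comment> \<open>The empty clique ensures that \<open>Max\<close> is taken over a nonempty set,
    even for empty \<open>W\<close>.\<close>
  have "{} \<in> {K. K \<subseteq> W \<and> clique K E}"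
    by simp
  then have "\<omega> \<in> card ` {K. K \<subseteq> W \<and> clique K E}"
    unfolding \<omega>_Max using fin by (intro Max_in) blast+
  then obtain K where K: "K \<subseteq> W" "clique K E" "card K = \<omega>"
    by auto
  have \<omega>_ge: "card L \<le> \<omega>" if "L \<subseteq> W" "clique L E" for L
    unfolding \<omega>_Max using that fin by (intro Max_ge) auto
  have "\<omega> \<le> \<chi>"
    using card_clique_le_indep_cover[OF _ K(1,2) \<chi>(1)] K(1,3) assms(1) finite_subset by metis
  have "\<chi> = \<omega> \<longleftrightarrow> clique_colourable E W"
  proof
    assume "\<chi> = \<omega>"
    then show "clique_colourable E W"
      using K \<chi>(1) unfolding clique_colourable_def by auto
  next
    assume "clique_colourable E W"
    then obtain L where "L \<subseteq> W" "clique L E" "indep_cover E W (card L)"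
      unfolding clique_colourable_def by blast
    then show "\<chi> = \<omega>"
      using \<chi>(2) \<omega>_ge \<open>\<omega> \<le> \<chi>\<close> by (meson le_antisym order_trans)
  qed
  then show ?thesis
    unfolding \<chi>_def \<omega>_def .
qed

lemma perfect_iff_clique_perfect:
  assumes "finite (fst G)" "simple_graph G"
  shows "perfect G \<longleftrightarrow> clique_perfect (snd G) (fst G)"
proof -
  have "{v} \<notin> snd G" for v
    using assms(2) unfolding simple_graph_def by force
  then have "chromatic_number (induced G W) = clique_number (induced G W)
      \<longleftrightarrow> clique_colourable (snd G) W" if "W \<subseteq> fst G" for W
    using chromatic_eq_clique_number_iff[of W "snd G" "fst G"] finite_subset[OF that assms(1)]
    by simp
  then show ?thesis
    unfolding perfect_def clique_perfect_def by blast
qed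

section \<open>The weak perfect graph theorem\<close>

text \<open>
  Lovasz' replication lemma. Of two vertices \<open>x\<close>, \<open>x'\<close> in the same fibre the second is deleted. If
  \<open>x\<close> lies in a maximum clique, then \<open>x'\<close> enlarges that clique and gets a new colour. Otherwise,
  removing the colour class of \<open>x\<close> except \<open>x\<close> itself destroys every maximum clique, and \<open>x'\<close>
  joins the removed vertices.
\<close>

lemma clique_colourable_blow_up:
  assumes perf: "clique_perfect E V"
    and "finite U" "f ` U \<subseteq> V"
    and edge: "\<And>u v. u \<in> U \<Longrightarrow> v \<in> U \<Longrightarrow> u \<noteq> v \<Longrightarrow> {u, v} \<in> F \<longleftrightarrow> f u = f v \<or> {f u, f v} \<in> E"
  shows "clique_colourable F U"
  using assms(2,3) edge
proof (induction "card U" arbitrary: U rule: less_induct)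
  case less
  note edge = less.prems(3)
  show ?case
  proof (cases "inj_on f U")
    case True
    have "clique_colourable E (f ` U)"
      using perf less.prems(2) by (simp add: clique_perfect_def)
    then obtain K C where K: "K \<subseteq> f ` U" "clique K E" and C: "finite C" "card C \<le> card K"
        "f ` U \<subseteq> \<Union>C" "\<forall>X \<in> C. indep X E"
      unfolding clique_colourable_def indep_cover_def by blast
    \<comment> \<open>With one vertex per fibre, \<open>U\<close> is a copy of its image: the clique
      is lifted along \<open>g\<close>, the cover is pulled back along \<open>f\<close>.\<close>
    define g where "g = the_inv_into U f"
    have g: "g (f u) = u" if "u \<in> U" for u
      using that True by (simp add: g_def the_inv_into_f_f)
    have fg: "f (g k) = k" "g k \<in> U" if "k \<in> K" for k
      using that K(1) g by force+
    then have "inj_on g K" "g ` K \<subseteq> U"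
      by (auto intro: inj_on_inverseI[of _ f])
    moreover have "clique (g ` K) F"
      unfolding clique_def
    proof (intro ballI impI)
      fix v w assume "v \<in> g ` K" "w \<in> g ` K" "v \<noteq> w"
      moreover from this have "v \<in> U" "w \<in> U" "f v \<in> K" "f w \<in> K" "f v \<noteq> f w"
        using fg by auto
      ultimately show "{v, w} \<in> F"
        using edge K(2) unfolding clique_def by blast
    qed
    moreover have "indep_cover F U (card (g ` K))"
    proof (rule indep_coverI[of "(\<lambda>X. {u \<in> U. f u \<in> X}) ` C"])
      show "card ((\<lambda>X. {u \<in> U. f u \<in> X}) ` C) \<le> card (g ` K)"
        using card_image_le[OF C(1)] C(2) \<open>inj_on g K\<close> by (metis card_image order_trans)
      show "U \<subseteq> \<Union> ((\<lambda>X. {u \<in> U. f u \<in> X}) ` C)"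
        using C(3) by auto
      fix X assume "X \<in> (\<lambda>X. {u \<in> U. f u \<in> X}) ` C"
      then obtain Y where Y: "indep Y E" "X = {u \<in> U. f u \<in> Y}"
        using C(4) by blast
      show "indep X F"
        unfolding indep_def
      proof (intro ballI impI)
        fix v w assume "v \<in> X" "w \<in> X" "v \<noteq> w"
        moreover from this have "f v \<noteq> f w"
          using Y(2) True by (auto simp: inj_on_def)
        ultimately show "{v, w} \<notin> F"
          using edge[of v w] Y unfolding indep_def by blast
      qed
    qed (use C in auto)
    ultimately show ?thesis
      unfolding clique_colourable_def by blast
  next
    case False
    then obtain x x' where x: "x \<in> U" "x' \<in> U" "x \<noteq> x'" "f x = f x'"
      unfolding inj_on_def by blast
    define U' where "U' = U - {x'}"
    have IH: "clique_colourable F H" if "H \<subseteq> U'" for H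
    proof (rule less.hyps)
      have "H \<subset> U"
        using that x by (auto simp: U'_def)
      then show "card H < card U"
        by (simp add: less.prems(1) psubset_card_mono)
      show "finite H"
        using \<open>H \<subset> U\<close> less.prems(1) finite_subset by blast
    qed (use that less.prems in \<open>auto simp: U'_def subset_iff\<close>)
    have "finite U'"
      using less.prems(1) by (simp add: U'_def)
    obtain K C where K: "K \<subseteq> U'" "clique K F" and C: "finite C" "card C \<le> card K"
        "U' \<subseteq> \<Union>C" "\<forall>X \<in> C. indep X F"
      using IH[of U'] unfolding clique_colourable_def indep_cover_def by blast
    have cov: "indep_cover F U' (card K)"
      using C unfolding indep_cover_def by blast
    show ?thesis
    proof (cases "\<exists>L \<subseteq> U'. clique L F \<and> card L = card K \<and> x \<in> L")
      case True
      then obtain L where L: "L \<subseteq> U'" "clique L F" "card L = card K" "x \<in> L"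
        by blast
      \<comment> \<open>\<open>x'\<close> is adjacent to \<open>x\<close> because they share a
        fibre, and to the other neighbours of \<open>x\<close> because adjacency depends only on
        images under \<open>f\<close>.\<close>
      have "{x', w} \<in> F" if "w \<in> L" for w
      proof (cases "w = x")
        case True
        then show ?thesis
          using edge[of x' x] x by auto
      next
        case False
        then have "{x, w} \<in> F" "w \<in> U" "w \<noteq> x'"
          using L that unfolding clique_def U'_def by auto
        then show ?thesis
          using edge[of x w] edge[of x' w] x False by auto
      qed
      then have "clique (insert x' L) F"
        using L(2) by (auto simp: clique_def insert_commute)
      moreover have "insert x' L \<subseteq> U" "x' \<notin> L" "finite L"
        using L(1) x(2) \<open>finite U'\<close> finite_subset by (auto simp: U'_def)
      moreover have "indep_cover F U (card K + 1)"
        using indep_cover_Un[OF cov indep_cover_indep[of "{x'}" F]] x(2)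
        by (auto simp: indep_def U'_def insert_absorb)
      ultimately show ?thesis
        unfolding clique_colourable_def using L(3)
        by (intro exI[of _ "insert x' L"]) simp
    next
      case noL: False
      obtain X where X: "X \<in> C" "x \<in> X"
        using C(3) x by (auto simp: U'_def)
      define H where "H = U' - (X - {x})"
      obtain M where M: "M \<subseteq> H" "clique M F" "indep_cover F H (card M)"
        using IH[of H] unfolding clique_colourable_def H_def by blast
      have M_U': "M \<subseteq> U'" "finite M"
        using M(1) \<open>finite U'\<close> finite_subset unfolding H_def by blast+
      have "card M \<le> card K"
        using card_clique_le_indep_cover[OF M_U'(2,1) M(2) cov] .
      moreover have "card M \<noteq> card K"
      proof
        assume eq: "card M = card K"
        then have "x \<notin> M"
          using noL M_U'(1) M(2) by blast
        \<comment> \<open>The only vertex of \<open>X\<close> left in \<open>H\<close> is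
          \<open>x\<close>, which is not in \<open>M\<close>. So the cover without \<open>X\<close>
          still covers \<open>M\<close>, which is too few sets for a clique of size
          \<open>card K\<close>.\<close>
        then have "M \<subseteq> \<Union>(C - {X})"
          using M(1) M_U'(1) C(3) X(1) unfolding H_def by blast
        then have "indep_cover F M (card (C - {X}))"
          using C(1,4) by (intro indep_coverI) auto
        then have "card M \<le> card (C - {X})"
          using card_clique_le_indep_cover M(2) M_U'(2) by blast
        moreover have "card (C - {X}) < card C"
          using X(1) C(1) by (rule card_Diff1_less[rotated])
        ultimately show False
          using eq C(2) by simp
      qed
      ultimately have "card M + 1 \<le> card K"
        by simp
      \<comment> \<open>\<open>X\<close> is independent and contains \<open>x\<close>; the other
        members of \<open>X\<close> in \<open>U'\<close> are non-neighbours of \<open>x\<close>,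
        hence of \<open>x'\<close>.\<close>
      have "indep ((X - {x}) \<inter> U' \<union> {x'}) F"
      proof -
        have "{x', w} \<notin> F" if "w \<in> X - {x}" "w \<in> U'" for w
        proof -
          have "{x, w} \<notin> F"
            using that C(4) X unfolding indep_def by auto
          then show ?thesis
            using edge[of x w] edge[of x' w] x that unfolding U'_def by auto
        qed
        then show ?thesis
          using C(4) X(1) by (auto simp: indep_def insert_commute)
      qed
      then have "indep_cover F (H \<union> ((X - {x}) \<inter> U' \<union> {x'})) (card M + 1)"
        using indep_cover_Un[OF M(3) indep_cover_indep] by blast
      then have "indep_cover F U (card K)"
        by (rule indep_cover_mono) (use \<open>card M + 1 \<le> card K\<close> in \<open>auto simp: H_def U'_def\<close>)
      then show ?thesis
        using K unfolding clique_colourable_def U'_def by blast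
    qed
  qed
qed

text \<open>
  It suffices to find a clique that meets all maximum independent sets. If each clique \<open>K\<close> missed
  one, say \<open>S K\<close>, replicate each vertex once for every \<open>S K\<close> containing it: counting shows that the
  blow-up \<open>Sigma Ks S\<close> has a clique with at least as many elements as there are cliques \<open>K\<close>, but
  its projection \<open>K0\<close> contributes nothing to the layer \<open>S K0\<close>.
\<close>

lemma clique_perfect_complement:
  assumes perf: "clique_perfect E V" and "finite V"
  shows "clique_perfect (- E) V"
  unfolding clique_perfect_def
proof (intro allI impI)
  fix U assume "U \<subseteq> V"
  then show "clique_colourable (- E) U"
  proof (induction "card U" arbitrary: U rule: less_induct)
    case less
    have finU: "finite U"
      using less.prems assms(2) finite_subset by blast
    define Ks where "Ks = {K. K \<subseteq> U \<and> clique K E}"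
    define Ss where "Ss = {S. S \<subseteq> U \<and> indep S E}"
    have finK: "finite Ks" and finS: "finite Ss"
      using finU by (simp_all add: Ks_def Ss_def)
    have "{} \<in> Ss" "{} \<in> Ks"
      by (auto simp: Ss_def Ks_def)
    define \<alpha> where "\<alpha> = Max (card ` Ss)"
    have \<alpha>_ge: "card S \<le> \<alpha>" if "S \<in> Ss" for S
      unfolding \<alpha>_def using that finS by (intro Max_ge) auto
    have "\<alpha> \<in> card ` Ss"
      unfolding \<alpha>_def using finS \<open>{} \<in> Ss\<close> by (intro Max_in) blast+
    then obtain S0 where S0: "S0 \<in> Ss" "card S0 = \<alpha>"
      by auto
    show ?case
    proof (cases "U = {}")
      case True
      then show ?thesis
        using indep_cover_card[of "{}"] unfolding clique_colourable_def by auto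
    next
      case False
      then obtain u where "u \<in> U"
        by blast
      then have "{u} \<in> Ss"
        by (simp add: Ss_def indep_def)
      then have "\<alpha> > 0"
        using \<alpha>_ge by fastforce
      have "\<exists>K \<in> Ks. \<forall>S \<in> Ss. card S = \<alpha> \<longrightarrow> S \<inter> K \<noteq> {}"
      proof (rule ccontr)
        assume "\<not> ?thesis"
        then obtain S where S: "\<And>K. K \<in> Ks \<Longrightarrow> S K \<in> Ss" "\<And>K. K \<in> Ks \<Longrightarrow> card (S K) = \<alpha>"
            "\<And>K. K \<in> Ks \<Longrightarrow> S K \<inter> K = {}"
          by metis
        define P where "P = Sigma Ks S"
        have finS': "finite (S K)" if "K \<in> Ks" for K
          using S(1)[OF that] finU finite_subset by (auto simp: Ss_def)
        then have finP: "finite P"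
          using finK by (auto simp: P_def)
        have cardP: "card P = card Ks * \<alpha>"
          unfolding P_def using finK finS' S(2) by simp
        have sndP: "snd ` P \<subseteq> U"
          using S(1) by (fastforce simp: P_def Ss_def)
        \<comment> \<open>Copies of one vertex are made adjacent, so that an independent set of the
          blow-up uses each vertex at most once and has at most \<alpha> elements.\<close>
        define F :: "('a set \<times> 'a) set set" where "F = {{p, q} | p q. snd p = snd q \<or> {snd p, snd q} \<in> E}"
        have F: "{p, q} \<in> F \<longleftrightarrow> snd p = snd q \<or> {snd p, snd q} \<in> E" for p q :: "'a set \<times> 'a"
          unfolding F_def by (cases p; cases q) (auto simp: doubleton_eq_iff insert_commute)
        have "clique_colourable F P"
          using clique_colourable_blow_up[OF perf finP, of snd F] sndP less.prems F by blast
        then obtain Q where Q: "Q \<subseteq> P" "clique Q F" "indep_cover F P (card Q)"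
          unfolding clique_colourable_def by blast
        have "card X \<le> \<alpha>" if "X \<subseteq> P" "indep X F" for X
        proof -
          have "inj_on snd X"
            using that(2) F unfolding inj_on_def indep_def by blast
          moreover have "indep (snd ` X) E"
            unfolding indep_def
          proof (intro ballI impI)
            fix v w assume "v \<in> snd ` X" "w \<in> snd ` X" "v \<noteq> w"
            then obtain p q where "p \<in> X" "q \<in> X" "p \<noteq> q" "v = snd p" "w = snd q"
              by blast
            then show "{v, w} \<notin> E"
              using that(2) F[of p q] unfolding indep_def by blast
          qed
          then have "snd ` X \<in> Ss"
            using that(1) sndP by (auto simp: Ss_def)
          ultimately show ?thesis
            using \<alpha>_ge card_image by metis
        qed
        then have "card P \<le> card Q * \<alpha>"
          using card_le_indep_cover_mult finP Q(3) by blast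
        then have "card Ks \<le> card Q"
          using cardP \<open>\<alpha> > 0\<close> by simp
        define K0 where "K0 = snd ` Q"
        have "clique K0 E"
          unfolding clique_def
        proof (intro ballI impI)
          fix v w assume "v \<in> K0" "w \<in> K0" "v \<noteq> w"
          then obtain p q where "p \<in> Q" "q \<in> Q" "p \<noteq> q" "v = snd p" "w = snd q"
            unfolding K0_def by blast
          then show "{v, w} \<in> E"
            using Q(2) F[of p q] \<open>v \<noteq> w\<close> unfolding clique_def by blast
        qed
        then have K0: "K0 \<in> Ks"
          using Q(1) sndP by (auto simp: K0_def Ks_def)
        \<comment> \<open>Two members of the clique \<open>Q\<close> in one layer \<open>K\<close>
          project into the independent set \<open>S K\<close>, so their projections must
          agree.\<close>
        have "inj_on fst Q"
        proof (rule inj_onI)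
          fix p q assume pq: "p \<in> Q" "q \<in> Q" "fst p = fst q"
          have P: "fst r \<in> Ks \<and> snd r \<in> S (fst r)" if "r \<in> Q" for r
            using that Q(1) by (cases r) (auto simp: P_def)
          then have "snd p \<in> S (fst p)" "snd q \<in> S (fst p)" "indep (S (fst p)) E"
            using pq S(1) by (fastforce simp: Ss_def)+
          moreover have "snd p = snd q \<or> {snd p, snd q} \<in> E"
            using pq Q(2) F unfolding clique_def by metis
          ultimately show "p = q"
            using pq(3) unfolding indep_def by (metis prod.expand)
        qed
        moreover have "fst ` Q \<subseteq> Ks - {K0}"
        proof
          fix K assume "K \<in> fst ` Q"
          then obtain x where x: "(K, x) \<in> Q"
            by force
          then have "K \<in> Ks" "x \<in> S K" "x \<in> K0"
            using Q(1) by (auto simp: P_def K0_def image_iff intro: bexI[of _ "(K, x)"])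
          then show "K \<in> Ks - {K0}"
            using S(3) K0 by blast
        qed
        ultimately have "card Q \<le> card (Ks - {K0})"
          using card_inj_on_le finK by blast
        also have "\<dots> < card Ks"
          using finK K0 by (rule card_Diff1_less)
        finally show False
          using \<open>card Ks \<le> card Q\<close> by simp
      qed
      \<comment> \<open>As \<open>K\<close> meets every maximum independent set, the independence
        number drops on \<open>U - K\<close>. Induction covers that part, and \<open>K\<close>
        itself is one more independent set of the complement.\<close>
      then obtain K where K: "K \<in> Ks" "\<And>S. S \<in> Ss \<Longrightarrow> card S = \<alpha> \<Longrightarrow> S \<inter> K \<noteq> {}"
        by blast
      then have "K \<noteq> {}"
        using S0 by blast
      then have "U - K \<subset> U"
        using K(1) by (auto simp: Ks_def)
      then obtain M where M: "M \<subseteq> U - K" "clique M (- E)" "indep_cover (- E) (U - K) (card M)"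
        using less.hyps[of "U - K"] less.prems finU psubset_card_mono
        unfolding clique_colourable_def by (meson order_trans psubset_imp_subset)
      have "M \<in> Ss"
        using M by (auto simp: Ss_def clique_uminus)
      moreover have "M \<inter> K = {}"
        using M(1) by blast
      ultimately have "card M + 1 \<le> \<alpha>"
        using \<alpha>_ge[of M] K(2)[of M] by linarith
      have "indep_cover (- E) ((U - K) \<union> K) (card M + 1)"
        using K(1) M(3)
        by (intro indep_cover_Un indep_cover_indep) (auto simp: Ks_def indep_uminus)
      then have "indep_cover (- E) U \<alpha>"
        using indep_cover_mono \<open>card M + 1 \<le> \<alpha>\<close> by fastforce
      then show ?thesis
        unfolding clique_colourable_def
        using S0 by (intro exI[of _ S0]) (simp add: clique_uminus Ss_def)
    qed
  qed
qed

section \<open>Disjointness graphs on four points\<close>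

lemma two_large_subsets_meet:
  assumes "finite X" "card X \<le> 3" "A \<subseteq> X" "B \<subseteq> X" "card A \<ge> 2" "card B \<ge> 2"
  shows "A \<inter> B \<noteq> {}"
proof
  assume "A \<inter> B = {}"
  then have "card (A \<union> B) = card A + card B"
    using assms finite_subset by (metis card_Un_disjoint)
  moreover have "card (A \<union> B) \<le> card X"
    using assms by (intro card_mono) auto
  ultimately show False
    using assms by linarith
qed

lemma clique_colourable_disjointness_nonempty:
  assumes "finite W" "finite B" "card B \<le> 4"
    and L: "\<And>v. v \<in> W \<Longrightarrow> L v \<subseteq> B" "\<And>v. v \<in> W \<Longrightarrow> L v \<noteq> {}"
    and edge: "\<And>u v. u \<in> W \<Longrightarrow> v \<in> W \<Longrightarrow> u \<noteq> v \<Longrightarrow> {u, v} \<in> E \<longleftrightarrow> L u \<inter> L v = {}"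
  shows "clique_colourable E W"
proof -
  \<comment> \<open>\<open>P\<close> collects the points whose singleton is a label; picking a
    vertex \<open>r i\<close> for each gives a clique of size \<open>card P\<close>. The set
    \<open>Q\<close> below is what the stars at \<open>P\<close> miss.\<close>
  define P where "P = {i \<in> B. \<exists>v \<in> W. L v = {i}}"
  have finP: "finite P"
    using assms(2) by (simp add: P_def)
  have "\<forall>i \<in> P. \<exists>v \<in> W. L v = {i}"
    by (auto simp: P_def)
  then obtain r where r: "\<And>i. i \<in> P \<Longrightarrow> r i \<in> W" "\<And>i. i \<in> P \<Longrightarrow> L (r i) = {i}"
    by metis
  have inj_r: "inj_on r P"
    using r(2) by (metis inj_onI singleton_inject)
  have R: "r ` P \<subseteq> W" "clique (r ` P) E" "card (r ` P) = card P"
    using r edge inj_r by (auto simp: clique_def card_image)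
  define Q where "Q = {v \<in> W. L v \<inter> P = {}}"
  have Q_card: "card (L v) \<ge> 2" if "v \<in> Q" for v
  proof -
    have "v \<in> W" "L v \<inter> P = {}"
      using that by (auto simp: Q_def)
    then have "L v \<noteq> {}" "finite (L v)" "\<nexists>i. L v = {i}"
      using L[of v] finite_subset[OF _ assms(2)] by (auto simp: P_def)
    then have "card (L v) \<noteq> 0" "card (L v) \<noteq> 1"
      by (auto simp: card_1_singleton_iff)
    then show ?thesis
      by linarith
  qed
  have star: "indep {v \<in> W. i \<in> L v} E" for i
    using edge by (auto simp: indep_def)
  have cov: "indep_cover E (W - Q) (card P)"
    by (rule indep_coverI[of "(\<lambda>i. {v \<in> W. i \<in> L v}) ` P"])
      (use finP star in \<open>auto simp: card_image_le Q_def\<close>)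
  \<comment> \<open>Here the bound 4 enters: away from \<open>i\<close>, labels of size at least 2
    live on at most 3 points and must meet.\<close>
  have Q_indep: "indep {v \<in> Q. i \<notin> L v} E" if "i \<in> B" for i
  proof -
    have "L u \<inter> L v \<noteq> {}" if "u \<in> Q" "v \<in> Q" "i \<notin> L u" "i \<notin> L v" for u v
    proof (rule two_large_subsets_meet[of "B - {i}"])
      show "card (B - {i}) \<le> 3"
        using assms(2,3) \<open>i \<in> B\<close> by simp
    qed (use that L(1) Q_card assms(2) in \<open>auto simp: Q_def\<close>)
    then show ?thesis
      using edge by (auto simp: indep_def Q_def)
  qed
  \<comment> \<open>Clique and cover have equal size in each case: \<open>card P\<close>,
    \<open>card P + 1\<close>, 1 and 2. In the last two no label is a singleton, so
    \<open>Q = W\<close>.\<close>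
  consider "Q = {}" | "Q \<noteq> {}" "P \<noteq> {}" | "Q \<noteq> {}" "P = {}" "indep Q E"
    | "Q \<noteq> {}" "P = {}" "\<not> indep Q E"
    by blast
  then show ?thesis
  proof cases
    case 1
    then show ?thesis
      using R cov unfolding clique_colourable_def by (intro exI[of _ "r ` P"]) simp
  next
    case 2
    \<comment> \<open>Labels in \<open>Q\<close> avoid \<open>P\<close>, so omitting
      \<open>i\<close> is no restriction and all of \<open>Q\<close> is independent. The label of
      \<open>q\<close> is disjoint from the singletons, so \<open>q\<close> enlarges the
      clique.\<close>
    then obtain q i where q: "q \<in> Q" and "i \<in> P"
      by blast
    then have "i \<in> B" "{v \<in> Q. i \<notin> L v} = Q"
      by (auto simp: P_def Q_def)
    then have "indep Q E"
      using Q_indep by metis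
    then have "indep_cover E ((W - Q) \<union> Q) (card P + 1)"
      using cov indep_cover_Un indep_cover_indep by blast
    moreover have "(W - Q) \<union> Q = W"
      by (auto simp: Q_def)
    moreover have "q \<in> W" "q \<notin> r ` P"
      using q r(2) by (auto simp: Q_def)
    moreover have "{q, r i} \<in> E" if "i \<in> P" for i
    proof -
      have "q \<noteq> r i" "L q \<inter> L (r i) = {}"
        using that q r(2) by (auto simp: Q_def)
      then show ?thesis
        using edge[of q "r i"] \<open>q \<in> W\<close> r(1) that by blast
    qed
    then have "clique (insert q (r ` P)) E"
      using R(2) by (auto simp: clique_def insert_commute)
    ultimately show ?thesis
      using R finP unfolding clique_colourable_def
      by (intro exI[of _ "insert q (r ` P)"]) simp
  next
    case 3
    then obtain q where "q \<in> W" "Q = W"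
      by (auto simp: Q_def)
    then show ?thesis
      using 3 indep_cover_indep[of W E] unfolding clique_colourable_def
      by (intro exI[of _ "{q}"]) (simp add: clique_def)
  next
    case 4
    then obtain u v where uv: "u \<in> W" "v \<in> W" "u \<noteq> v" "{u, v} \<in> E" and "Q = W"
      by (auto simp: Q_def indep_def)
    obtain i where "i \<in> B"
      using L uv(1) by blast
    have "indep_cover E ({v \<in> W. i \<in> L v} \<union> {v \<in> Q. i \<notin> L v}) (1 + 1)"
      using star Q_indep[OF \<open>i \<in> B\<close>] by (intro indep_cover_Un indep_cover_indep)
    then have "indep_cover E W (card {u, v})"
      by (rule indep_cover_mono) (use \<open>Q = W\<close> uv in auto)
    then show ?thesis
      using uv unfolding clique_colourable_def
      by (intro exI[of _ "{u, v}"]) (simp add: clique_def insert_commute)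
  qed
qed

text \<open>Vertices with empty label are adjacent to all others: they join the clique, and each
  gets a colour of its own.\<close>

lemma clique_perfect_disjointness:
  assumes "finite V" "finite B" "card B \<le> 4"
    and L: "\<And>v. v \<in> V \<Longrightarrow> L v \<subseteq> B"
    and edge: "\<And>u v. u \<in> V \<Longrightarrow> v \<in> V \<Longrightarrow> u \<noteq> v \<Longrightarrow> {u, v} \<in> E \<longleftrightarrow> L u \<inter> L v = {}"
  shows "clique_perfect E V"
  unfolding clique_perfect_def
proof (intro allI impI)
  fix W assume "W \<subseteq> V"
  define Z where "Z = {v \<in> W. L v = {}}"
  have "finite W"
    using \<open>W \<subseteq> V\<close> assms(1) finite_subset by blast
  then have "finite Z"
    by (simp add: Z_def)
  have "clique_colourable E (W - Z)"
  proof (rule clique_colourable_disjointness_nonempty[of _ B L])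
    show "{u, v} \<in> E \<longleftrightarrow> L u \<inter> L v = {}" if "u \<in> W - Z" "v \<in> W - Z" "u \<noteq> v" for u v
      using edge that \<open>W \<subseteq> V\<close> by blast
  qed (use \<open>finite W\<close> \<open>W \<subseteq> V\<close> assms(2,3) L in \<open>auto simp: Z_def\<close>)
  then obtain K where K: "K \<subseteq> W - Z" "clique K E" "indep_cover E (W - Z) (card K)"
    unfolding clique_colourable_def by blast
  have "clique (K \<union> Z) E"
  proof (rule clique_Un[OF K(2)])
    show "clique Z E"
      using edge \<open>W \<subseteq> V\<close> by (auto simp: clique_def Z_def)
    show "\<forall>v \<in> K. \<forall>w \<in> Z. v \<noteq> w \<longrightarrow> {v, w} \<in> E"
      using edge K(1) \<open>W \<subseteq> V\<close> unfolding Z_def by blast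
  qed
  moreover have "indep_cover E ((W - Z) \<union> Z) (card K + card Z)"
    using K(3) indep_cover_card[OF \<open>finite Z\<close>] by (rule indep_cover_Un)
  moreover have "card (K \<union> Z) = card K + card Z"
    using K(1) \<open>finite W\<close> \<open>finite Z\<close> by (intro card_Un_disjoint) (auto intro: finite_subset)
  moreover have "(W - Z) \<union> Z = W" "K \<union> Z \<subseteq> W"
    using K(1) by (auto simp: Z_def)
  ultimately show "clique_colourable E W"
    unfolding clique_colourable_def by metis
qed

section \<open>Five-cycles and induced cycles\<close>

text \<open>Cliques and independent sets have at most two elements, and two colours then reach at
  most four vertices.\<close>

lemma not_clique_colourable_five:
  assumes "card W = 5"
    and "\<And>X. X \<subseteq> W \<Longrightarrow> card X = 3 \<Longrightarrow> \<not> clique X E \<and> \<not> indep X E"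
  shows "\<not> clique_colourable E W"
proof
  have fin: "finite W"
    using assms(1) by (metis card.infinite zero_neq_numeral)
  have small: "card X \<le> 2" if X: "X \<subseteq> W" "clique X E \<or> indep X E" for X
  proof (rule ccontr)
    assume "\<not> card X \<le> 2"
    then obtain Y where "Y \<subseteq> X" "card Y = 3"
      using obtain_subset_with_card_n[of 3 X] by force
    then show False
      using assms(2)[of Y] X smaller_clique smaller_indep by blast
  qed
  assume "clique_colourable E W"
  then obtain K where K: "K \<subseteq> W" "clique K E" "indep_cover E W (card K)"
    unfolding clique_colourable_def by blast
  have "card W \<le> card K * 2"
    using card_le_indep_cover_mult[OF fin K(3)] small by blast
  then show False
    using small[of K] K assms(1) by simp
qed

text \<open>The five-cycle is the classical witness for the Ramsey bound R(3,3) > 5; all index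
  triples are enumerated.\<close>

lemma five_cycle_triples:
  fixes i j k :: nat
  assumes "i < 5" "j < 5" "k < 5" "i \<noteq> j" "j \<noteq> k" "i \<noteq> k"
  defines "adj \<equiv> \<lambda>i j. j = (i + 1) mod 5 \<or> i = (j + 1) mod (5::nat)"
  shows "\<not> (adj i j \<and> adj j k \<and> adj i k)" "adj i j \<or> adj j k \<or> adj i k"
proof -
  have less5: "n = 0 \<or> n = 1 \<or> n = 2 \<or> n = 3 \<or> n = 4" if "n < 5" for n :: nat
    using that by linarith
  have "\<not> (adj i j \<and> adj j k \<and> adj i k) \<and> (adj i j \<or> adj j k \<or> adj i k)"
    using less5[OF assms(1)] less5[OF assms(2)] less5[OF assms(3)] assms(4-6) unfolding adj_def
    by (elim disjE) simp_all
  then show "\<not> (adj i j \<and> adj j k \<and> adj i k)" "adj i j \<or> adj j k \<or> adj i k"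
    by blast+
qed

text \<open>The Ramsey property is invariant under complementation, so both graphs are treated
  without reordering the complement into a five-cycle.\<close>

lemma five_cycle_not_clique_colourable:
  fixes x :: "nat \<Rightarrow> 'a"
  assumes inj: "inj_on x {..<5}"
    and edge: "\<And>i j. i < 5 \<Longrightarrow> j < 5 \<Longrightarrow> i \<noteq> j \<Longrightarrow>
      {x i, x j} \<in> E \<longleftrightarrow> j = (i + 1) mod 5 \<or> i = (j + 1) mod 5"
  shows "\<not> clique_colourable E (x ` {..<5})" "\<not> clique_colourable (- E) (x ` {..<5})"
proof -
  have ramsey: "\<not> clique X E \<and> \<not> indep X E" if X: "X \<subseteq> x ` {..<5}" "card X = 3" for X
  proof -
    obtain a b c where abc: "X = {a, b, c}" "a \<noteq> b" "b \<noteq> c" "a \<noteq> c"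
      using X(2) by (auto simp: card_3_iff)
    then obtain i j k where ijk: "a = x i" "b = x j" "c = x k" "i < 5" "j < 5" "k < 5"
      using X(1) by auto
    then have ne: "i \<noteq> j" "j \<noteq> k" "i \<noteq> k"
      using abc by auto
    have "{a, b} \<in> E \<longleftrightarrow> j = (i + 1) mod 5 \<or> i = (j + 1) mod 5"
      "{b, c} \<in> E \<longleftrightarrow> k = (j + 1) mod 5 \<or> j = (k + 1) mod 5"
      "{a, c} \<in> E \<longleftrightarrow> k = (i + 1) mod 5 \<or> i = (k + 1) mod 5"
      using edge ijk ne by simp_all
    then have "\<not> ({a, b} \<in> E \<and> {b, c} \<in> E \<and> {a, c} \<in> E)"
      "{a, b} \<in> E \<or> {b, c} \<in> E \<or> {a, c} \<in> E"
      using five_cycle_triples[OF ijk(4-6) ne] by simp_all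
    then show ?thesis
      using abc unfolding clique_def indep_def by blast
  qed
  moreover have "card (x ` {..<5}) = 5"
    using inj by (simp add: card_image)
  ultimately show "\<not> clique_colourable E (x ` {..<5})" "\<not> clique_colourable (- E) (x ` {..<5})"
    using not_clique_colourable_five[of "x ` {..<5}" E]
      not_clique_colourable_five[of "x ` {..<5}" "- E"]
    by (simp_all add: clique_uminus indep_uminus)
qed

section \<open>Induced cycles of length at least four\<close>

lemma cycle_edges_eq_image:
  "cycle_edges xs = (\<lambda>i. {xs ! i, xs ! ((i + 1) mod length xs)}) ` {..<length xs}"
  unfolding cycle_edges_def by blast

text \<open>Consecutive vertices are distinct because edges have two elements, so distinctness is
  assumed for the diagonals alone.\<close>

lemma not_chordal_if_four_cycle:
  assumes "simple_graph G" "{a, b} \<in> snd G" "{b, c} \<in> snd G" "{c, d} \<in> snd G" "{d, a} \<in> snd G"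
    and "{a, c} \<notin> snd G" "{b, d} \<notin> snd G" "a \<noteq> c" "b \<noteq> d"
  shows "\<not> chordal G"
proof -
  let ?xs = "[a, b, c, d]"
  have edgeD: "e \<subseteq> fst G" "card e = 2" if "e \<in> snd G" for e
    using assms(1) that by (auto simp: simple_graph_def)
  have "a \<noteq> b" "b \<noteq> c" "c \<noteq> d" "d \<noteq> a"
    using edgeD(2)[OF assms(2)] edgeD(2)[OF assms(3)] edgeD(2)[OF assms(4)] edgeD(2)[OF assms(5)]
    by auto
  then have "distinct ?xs"
    using assms by auto
  moreover have "set ?xs \<subseteq> fst G"
    using edgeD(1)[OF assms(2)] edgeD(1)[OF assms(4)] by auto
  moreover have "cycle_edges ?xs = {{a, b}, {b, c}, {c, d}, {d, a}}"
  proof -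
    have "{..<length ?xs} = {0, 1, 2, 3}"
      by auto
    then show ?thesis
      unfolding cycle_edges_eq_image by simp
  qed
  moreover have "{e \<in> snd G. e \<subseteq> set ?xs} = {{a, b}, {b, c}, {c, d}, {d, a}}"
  proof (intro equalityI subsetI)
    fix e assume e: "e \<in> {e \<in> snd G. e \<subseteq> set ?xs}"
    then obtain u v where uv: "e = {u, v}" "u \<noteq> v"
      using edgeD(2)[of e] unfolding card_2_iff by blast
    then have "u \<in> {a, b, c, d}" "v \<in> {a, b, c, d}"
      using e by simp_all
    moreover have "e \<noteq> {a, c}" "e \<noteq> {b, d}"
      using e assms(6,7) by blast+
    ultimately show "e \<in> {{a, b}, {b, c}, {c, d}, {d, a}}"
      using uv by (auto simp: doubleton_eq_iff)
  qed (use assms in auto)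
  ultimately have "induced_cycle G ?xs"
    by (simp add: induced_cycle_def induced_def)
  moreover have "4 \<le> length ?xs"
    by simp
  ultimately show ?thesis
    unfolding chordal_def by blast
qed

text \<open>
  In an induced cycle, \<open>b\<close>, \<open>d\<close> are the neighbours of \<open>a\<close> and \<open>b\<close>, \<open>e\<close> those of \<open>c\<close>; for a cycle of
  length 4 the vertices \<open>d\<close> and \<open>e\<close> coincide.
\<close>

lemma not_chordalE:
  assumes "\<not> chordal G"
  obtains a b c d e where "a \<noteq> c" "b \<noteq> d" "b \<noteq> e"
    "{a, b} \<in> snd G" "{a, d} \<in> snd G" "{c, b} \<in> snd G" "{c, e} \<in> snd G"
    "{a, c} \<notin> snd G" "{b, d} \<notin> snd G" "{b, e} \<notin> snd G"
proof -
  obtain xs where xs: "induced_cycle G xs" "4 \<le> length xs"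
    using assms unfolding chordal_def by blast
  define m where "m = length xs"
  have m: "4 \<le> m" and dist: "distinct xs"
    and E: "{e \<in> snd G. e \<subseteq> set xs} = cycle_edges xs"
    using xs by (auto simp: m_def induced_cycle_def induced_def)
  have inj: "xs ! i = xs ! j \<longleftrightarrow> i = j" if "i < m" "j < m" for i j
    using that dist by (simp add: m_def nth_eq_iff_index_eq)
  have edge: "{xs ! i, xs ! j} \<in> snd G \<longleftrightarrow> j = (i + 1) mod m \<or> i = (j + 1) mod m"
    if "i < m" "j < m" for i j
  proof -
    have "{xs ! i, xs ! j} \<subseteq> set xs"
      using that by (simp add: m_def)
    then have "{xs ! i, xs ! j} \<in> snd G \<longleftrightarrow> {xs ! i, xs ! j} \<in> cycle_edges xs"
      using E by blast
    also have "\<dots> \<longleftrightarrow> j = (i + 1) mod m \<or> i = (j + 1) mod m"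
    proof -
      have "{xs ! i, xs ! j} = {xs ! k, xs ! ((k + 1) mod m)} \<longleftrightarrow>
          i = k \<and> j = (k + 1) mod m \<or> i = (k + 1) mod m \<and> j = k" if "k < m" for k
        unfolding doubleton_eq_iff using inj that \<open>i < m\<close> \<open>j < m\<close> m by simp
      then show ?thesis
        using that unfolding cycle_edges_def m_def[symmetric] by blast
    qed
    finally show ?thesis .
  qed
  have mod4: "4 mod m = (if m = 4 then 0 else 4)"
    using m by simp
  show ?thesis
    \<comment> \<open>The instances are for \<open>a\<close>, \<open>c\<close>, \<open>b\<close>,
      \<open>d\<close>, \<open>e\<close> in this order. The successor of index 3 wraps around to 0
      exactly when \<open>m = 4\<close>, which is what \<open>mod4\<close> records.\<close>
    by (rule that[of "xs ! 0" "xs ! 2" "xs ! 1" "xs ! (m - 1)" "xs ! 3"])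
      (use m mod4 in \<open>auto simp: edge inj mod_Suc\<close>)
qed

section \<open>Skeleton graphs\<close>

context finite_dimensional_vector_space
begin

section \<open>Skeletons and coordinates\<close>

lemma skeleton_subset: "skeleton scale Basis a \<subseteq> Basis"
  by (auto simp: skeleton_def)

lemma representation_Basis_inj:
  assumes "representation Basis a = representation Basis b"
  shows "a = b"
proof -
  have "(\<Sum>v | representation Basis x v \<noteq> 0. scale (representation Basis x v) v) = x" for x
    by (rule sum_nonzero_representation_eq) (simp_all add: independent_Basis span_Basis)
  then show ?thesis
    using assms by metis
qed

lemma representation_eq_0_outside: "v \<notin> Basis \<Longrightarrow> representation Basis a v = 0"
  using representation_ne_zero by blast

lemma skeleton_eq_empty_iff: "skeleton scale Basis a = {} \<longleftrightarrow> a = 0"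
proof
  assume "skeleton scale Basis a = {}"
  then have "representation Basis a v = 0" for v
    by (cases "v \<in> Basis") (auto simp: skeleton_def representation_eq_0_outside)
  then have "representation Basis a = representation Basis 0"
    by (simp add: fun_eq_iff representation_zero)
  then show "a = 0"
    by (rule representation_Basis_inj)
qed (simp add: skeleton_def representation_zero)

text \<open>The sum of the vectors in \<open>S\<close> has the indicator function of
  \<open>S\<close> as its coordinates.\<close>

lemma skeleton_surj:
  assumes "S \<subseteq> Basis"
  obtains a where "skeleton scale Basis a = S"
proof
  have "representation Basis (\<Sum>v \<in> S. v) = (\<lambda>b. \<Sum>v \<in> S. representation Basis v b)"
    using independent_Basis by (intro representation_sum) (auto simp: span_Basis)
  also have "\<dots> = (\<lambda>b. if b \<in> S then 1 else 0)"
  proof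
    fix b
    have "(\<Sum>v \<in> S. representation Basis v b) = (\<Sum>v \<in> S. if b = v then 1 else 0)"
      using assms by (intro sum.cong) (auto simp: representation_basis[OF independent_Basis])
    then show "(\<Sum>v \<in> S. representation Basis v b) = (if b \<in> S then 1 else 0)"
      using finite_subset[OF assms finite_Basis] by simp
  qed
  finally show "skeleton scale Basis (\<Sum>v \<in> S. v) = S"
    using assms by (auto simp: skeleton_def)
qed

lemma skeleton_scale: "r \<noteq> 0 \<Longrightarrow> skeleton scale Basis (scale r a) = skeleton scale Basis a"
  by (simp add: skeleton_def representation_scale[OF independent_Basis] span_Basis)

text \<open>The only nonzero coefficient is 1, so the support determines all coordinates.\<close>

lemma skeleton_inj_two_element_field:
  assumes "card (UNIV :: 'a set) = 2" "skeleton scale Basis a = skeleton scale Basis b"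
  shows "a = b"
proof (rule representation_Basis_inj, rule ext)
  fix v
  have "finite (UNIV :: 'a set)"
    using assms(1) by (intro card_ge_0_finite) simp
  then have "{0, 1} = (UNIV :: 'a set)"
    by (rule card_subset_eq) (use assms(1) in simp_all)
  then have two: "x = 0 \<or> x = 1" for x :: 'a
    by (metis UNIV_I insertE singletonD)
  show "representation Basis a v = representation Basis b v"
  proof (cases "v \<in> Basis")
    case True
    then have "representation Basis a v = 0 \<longleftrightarrow> representation Basis b v = 0"
      using assms(2) by (auto simp: skeleton_def)
    then show ?thesis
      using two[of "representation Basis a v"] two[of "representation Basis b v"] by auto
  qed (simp add: representation_eq_0_outside)
qed

lemma finite_UNIV_vectors:
  assumes "finite (UNIV :: 'a set)"
  shows "finite (UNIV :: 'b set)"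
proof (rule inj_on_finite)
  show "inj (representation Basis)"
    by (rule injI) (rule representation_Basis_inj)
  show "range (representation Basis) \<subseteq> {f. \<forall>v. (v \<in> Basis \<longrightarrow> f v \<in> UNIV) \<and> (v \<notin> Basis \<longrightarrow> f v = 0)}"
    using representation_eq_0_outside by auto
  show "finite {f. \<forall>v. (v \<in> Basis \<longrightarrow> f v \<in> (UNIV :: 'a set)) \<and> (v \<notin> Basis \<longrightarrow> f v = 0)}"
    by (rule finite_set_of_finite_funs[OF finite_Basis assms])
qed

section \<open>Adjacency in terms of labels\<close>

text \<open>The zero vector has empty skeleton, so the intersection condition already forces both
  ends to be nonzero.\<close>

lemma IG_edge_iff:
  "{a, b} \<in> snd (IG scale Basis) \<longleftrightarrow>
     a \<noteq> b \<and> skeleton scale Basis a \<inter> skeleton scale Basis b \<noteq> {}"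
proof -
  have "{a, b} \<in> snd (IG scale Basis) \<longleftrightarrow> a \<noteq> 0 \<and> b \<noteq> 0 \<and> a \<noteq> b \<and>
      skeleton scale Basis a \<inter> skeleton scale Basis b \<noteq> {}"
    unfolding IG_def snd_conv mem_Collect_eq doubleton_eq_iff by blast
  moreover have "skeleton scale Basis 0 = {}"
    by (simp add: skeleton_eq_empty_iff)
  ultimately show ?thesis
    by blast
qed

definition coskeleton :: "'b \<Rightarrow> 'b set" where
  "coskeleton a = Basis - skeleton scale Basis a"

lemma coskeleton_subset: "coskeleton a \<subseteq> Basis"
  by (auto simp: coskeleton_def)

text \<open>The inclusion is proper because the coskeleton \<open>Basis\<close> belongs to the zero
  vector.\<close>

lemma coskeleton_surj:
  assumes "T \<subset> Basis"
  obtains a where "a \<noteq> 0" "coskeleton a = T"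
proof -
  obtain a where a: "skeleton scale Basis a = Basis - T"
    using skeleton_surj[of "Basis - T"] by blast
  then have "a \<noteq> 0"
    using assms skeleton_eq_empty_iff by blast
  then show thesis
    using that[of a] a assms by (auto simp: coskeleton_def)
qed

text \<open>Unlike for the intersection graph, the conditions on zero stay: its coskeleton
  \<open>Basis\<close> is disjoint from the empty coskeleton of a vector with full skeleton.\<close>

lemma UG_edge_iff:
  "{a, b} \<in> snd (UG scale Basis) \<longleftrightarrow>
     a \<noteq> 0 \<and> b \<noteq> 0 \<and> a \<noteq> b \<and> coskeleton a \<inter> coskeleton b = {}"
proof -
  have "{a, b} \<in> snd (UG scale Basis) \<longleftrightarrow> a \<noteq> 0 \<and> b \<noteq> 0 \<and> a \<noteq> b \<and>
      skeleton scale Basis a \<union> skeleton scale Basis b = Basis"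
    unfolding UG_def snd_conv mem_Collect_eq doubleton_eq_iff by blast
  moreover have "skeleton scale Basis a \<union> skeleton scale Basis b = Basis \<longleftrightarrow>
      coskeleton a \<inter> coskeleton b = {}"
    using skeleton_subset[of a] skeleton_subset[of b] unfolding coskeleton_def by blast
  ultimately show ?thesis
    by simp
qed

lemma obtain_basis_vectors:
  assumes "n \<le> card Basis"
  obtains b :: "nat \<Rightarrow> 'b" where "inj_on b {..<n}" "b ` {..<n} \<subseteq> Basis"
proof -
  obtain Y where Y: "Y \<subseteq> Basis" "card Y = n" "finite Y"
    using obtain_subset_with_card_n[OF assms] by blast
  then obtain b where "bij_betw b {..<n} Y"
    using ex_bij_betw_nat_finite[OF Y(3)] by (auto simp: atLeast0LessThan)
  then show thesis
    using that Y(1) by (auto simp: bij_betw_def)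
qed

section \<open>Chordality of the skeleton graphs\<close>

lemma IG_chordal_iff: "chordal (IG scale Basis) \<longleftrightarrow> card Basis \<le> 3"
proof
  assume chordal: "chordal (IG scale Basis)"
  show "card Basis \<le> 3"
  proof (rule ccontr)
    assume "\<not> card Basis \<le> 3"
    then obtain b :: "nat \<Rightarrow> 'b" where b: "inj_on b {..<4}" "b ` {..<4} \<subseteq> Basis"
      using obtain_basis_vectors[of 4] by auto
    have b_eq: "b i = b j \<longleftrightarrow> i = j" if "i < 4" "j < 4" for i j
      using b(1) that by (auto simp: inj_on_def)
    have "\<exists>a. skeleton scale Basis a = {b i, b j}" if "i < 4" "j < 4" for i j
      using skeleton_surj[of "{b i, b j}"] b(2) that by (metis bot_least image_subset_iff insert_subset lessThan_iff)
    then obtain s where s: "\<And>i j. i < 4 \<Longrightarrow> j < 4 \<Longrightarrow> skeleton scale Basis (s i j) = {b i, b j}"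
      by metis
    have s_eqD: "{b i, b j} = {b k, b l}"
      if "s i j = s k l" "i < 4" "j < 4" "k < 4" "l < 4" for i j k l
      using s that by metis
    \<comment> \<open>The labels are the edges of a four-cycle on \<open>b 0\<close>, ...,
      \<open>b 3\<close>: consecutive ones share a point, opposite ones are disjoint.\<close>
    have "\<not> chordal (IG scale Basis)"
      by (rule not_chordal_if_four_cycle[OF simple_graph_IG, of "s 0 1" "s 1 2" _ _ "s 2 3" "s 3 0"])
        (auto simp: IG_edge_iff s b_eq doubleton_eq_iff dest!: s_eqD)
    then show False
      using chordal by contradiction
  qed
next
  assume card: "card Basis \<le> 3"
  show "chordal (IG scale Basis)"
  proof (rule ccontr)
    let ?S = "skeleton scale Basis"
    \<comment> \<open>The skeleton of \<open>a\<close> meets two disjoint skeletons, hence contains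
      two points.\<close>
    have two: "card (?S a) \<ge> 2"
      if "{a, b} \<in> snd (IG scale Basis)" "{a, d} \<in> snd (IG scale Basis)"
        "{b, d} \<notin> snd (IG scale Basis)" "b \<noteq> d" for a b d
    proof -
      have "?S a \<inter> ?S b \<noteq> {}" "?S a \<inter> ?S d \<noteq> {}" "?S b \<inter> ?S d = {}"
        using that by (auto simp: IG_edge_iff)
      then obtain x y where "x \<in> ?S a" "y \<in> ?S a" "x \<noteq> y"
        by blast
      then have "card {x, y} \<le> card (?S a)"
        using finite_subset[OF skeleton_subset finite_Basis] by (intro card_mono) auto
      then show ?thesis
        using \<open>x \<noteq> y\<close> by simp
    qed
    assume "\<not> chordal (IG scale Basis)"
    then obtain a b c d e where "a \<noteq> c" "b \<noteq> d" "b \<noteq> e"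
      "{a, b} \<in> snd (IG scale Basis)" "{a, d} \<in> snd (IG scale Basis)"
      "{c, b} \<in> snd (IG scale Basis)" "{c, e} \<in> snd (IG scale Basis)"
      "{a, c} \<notin> snd (IG scale Basis)" "{b, d} \<notin> snd (IG scale Basis)" "{b, e} \<notin> snd (IG scale Basis)"
      by (rule not_chordalE)
    then have "card (?S a) \<ge> 2" "card (?S c) \<ge> 2" "?S a \<inter> ?S c = {}"
      using two by (auto simp: IG_edge_iff)
    then show False
      using two_large_subsets_meet[OF finite_Basis card] skeleton_subset by blast
  qed
qed

lemma UG_chordal_iff:
  assumes "finite (UNIV :: 'a set)" "card Basis \<ge> 1"
  shows "chordal (UG scale Basis) \<longleftrightarrow>
    card Basis = 1 \<or> card Basis \<in> {2, 3} \<and> card (UNIV :: 'a set) = 2"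
proof
  assume chordal: "chordal (UG scale Basis)"
  have "card Basis = 1" if ge2: "card (UNIV :: 'a set) \<noteq> 2"
  proof (rule ccontr)
    assume "card Basis \<noteq> 1"
    then obtain b :: "nat \<Rightarrow> 'b" where b: "inj_on b {..<2}" "b ` {..<2} \<subseteq> Basis"
      using obtain_basis_vectors[of 2] assms(2) by auto
    then have b01: "b 0 \<in> Basis" "b 1 \<in> Basis" "b 0 \<noteq> b 1"
      using inj_on_eq_iff[OF b(1), of 0 1] by auto
    have "\<exists>r :: 'a. r \<notin> {0, 1}"
    proof (rule ccontr)
      assume "\<not> ?thesis"
      then have "UNIV = {0, 1 :: 'a}"
        by blast
      then have "card (UNIV :: 'a set) = card {0, 1 :: 'a}"
        by simp
      then show False
        using ge2 by simp
    qed
    then obtain r :: 'a where r: "r \<noteq> 0" "r \<noteq> 1"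
      by blast
    \<comment> \<open>The four-cycle is \<open>p\<close>, \<open>q\<close>,
      \<open>scale r p\<close>, \<open>scale r q\<close>: scaling by \<open>r\<close> gives a second
      vector with the same nonempty coskeleton, hence a non-neighbour.\<close>
    obtain p where p: "p \<noteq> 0" "coskeleton p = {b 0}"
      by (rule coskeleton_surj[of "{b 0}"]) (use b01 in auto)
    obtain q where q: "q \<noteq> 0" "coskeleton q = {b 1}"
      by (rule coskeleton_surj[of "{b 1}"]) (use b01 in auto)
    have "scale r x \<noteq> x" if "x \<noteq> 0" for x
      using that r scale_cancel_right[of r x 1] by simp
    moreover have "coskeleton (scale r x) = coskeleton x" for x
      using r skeleton_scale by (simp add: coskeleton_def)
    ultimately have "\<not> chordal (UG scale Basis)"
      using p q r b01(3)
      by (intro not_chordal_if_four_cycle[OF simple_graph_UG, of p q _ _ "scale r p" "scale r q"])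
        (auto simp: UG_edge_iff dest: sym)
    then show False
      using chordal by contradiction
  qed
  moreover have "card Basis \<le> 3"
  proof (rule ccontr)
    assume "\<not> card Basis \<le> 3"
    then obtain b :: "nat \<Rightarrow> 'b" where b: "inj_on b {..<4}" "b ` {..<4} \<subseteq> Basis"
      using obtain_basis_vectors[of 4] by auto
    have b_eq: "b i = b j \<longleftrightarrow> i = j" if "i < 4" "j < 4" for i j
      using b(1) that by (auto simp: inj_on_def)
    have "\<exists>a. a \<noteq> 0 \<and> coskeleton a = {b i, b j}" if "i < 4" "j < 4" for i j
    proof -
      have "card {b i, b j} \<le> 2"
        by (simp add: card_insert_if)
      then have "{b i, b j} \<noteq> Basis"
        using \<open>\<not> card Basis \<le> 3\<close> by fastforce
      moreover have "{b i, b j} \<subseteq> Basis"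
        using b(2) that by auto
      ultimately show ?thesis
        using coskeleton_surj[of "{b i, b j}"] by (metis psubsetI)
    qed
    then obtain c where c: "\<And>i j. i < 4 \<Longrightarrow> j < 4 \<Longrightarrow> c i j \<noteq> 0"
      "\<And>i j. i < 4 \<Longrightarrow> j < 4 \<Longrightarrow> coskeleton (c i j) = {b i, b j}"
      by metis
    have c_eqD: "{b i, b j} = {b k, b l}"
      if "c i j = c k l" "i < 4" "j < 4" "k < 4" "l < 4" for i j k l
      using c(2) that by metis
    \<comment> \<open>The coskeletons are in turn \<open>{b 0}\<close>, \<open>{b 2}\<close>,
      \<open>{b 0, b 1}\<close>, \<open>{b 2, b 3}\<close>: consecutive ones are disjoint, opposite
      ones share \<open>b 0\<close> or \<open>b 2\<close>. Equal indices encode the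
      singletons.\<close>
    have "\<not> chordal (UG scale Basis)"
      by (rule not_chordal_if_four_cycle[OF simple_graph_UG, of "c 0 0" "c 2 2" _ _ "c 0 1" "c 2 3"])
        (auto simp: UG_edge_iff c b_eq doubleton_eq_iff dest!: c_eqD)
    then show False
      using chordal by contradiction
  qed
  ultimately show "card Basis = 1 \<or> card Basis \<in> {2, 3} \<and> card (UNIV :: 'a set) = 2"
    using assms(2) by auto
next
  assume small: "card Basis = 1 \<or> card Basis \<in> {2, 3} \<and> card (UNIV :: 'a set) = 2"
  show "chordal (UG scale Basis)"
  proof (rule ccontr)
    \<comment> \<open>The coskeletons of \<open>b\<close> and \<open>d\<close> meet but differ, so
      their union has at least two points, all avoided by the coskeleton of
      \<open>a\<close>.\<close>
    have bound: "card (coskeleton a) + 2 \<le> card Basis"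
      if "{a, b} \<in> snd (UG scale Basis)" "{a, d} \<in> snd (UG scale Basis)"
        "{b, d} \<notin> snd (UG scale Basis)" "b \<noteq> d" "coskeleton b \<noteq> coskeleton d" for a b d
    proof -
      have *: "coskeleton a \<inter> (coskeleton b \<union> coskeleton d) = {}" "coskeleton b \<inter> coskeleton d \<noteq> {}"
        using that by (auto simp: UG_edge_iff)
      then obtain x y where "x \<in> coskeleton b \<union> coskeleton d" "y \<in> coskeleton b \<union> coskeleton d" "x \<noteq> y"
        using \<open>coskeleton b \<noteq> coskeleton d\<close> by blast
      then have xy: "coskeleton a \<inter> {x, y} = {}" "{x, y} \<subseteq> Basis" "card {x, y} = 2"
        using *(1) coskeleton_subset by auto
      have "card (coskeleton a) + card {x, y} = card (coskeleton a \<union> {x, y})"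
        using finite_subset[OF coskeleton_subset finite_Basis] xy(1)
        by (intro card_Un_disjoint[symmetric]) auto
      also have "\<dots> \<le> card Basis"
        using finite_Basis coskeleton_subset xy(2) by (intro card_mono) auto
      finally show ?thesis
        using xy(3) by simp
    qed
    assume "\<not> chordal (UG scale Basis)"
    then obtain a b c d e where ne: "a \<noteq> c" "b \<noteq> d" "b \<noteq> e" and
      E: "{a, b} \<in> snd (UG scale Basis)" "{a, d} \<in> snd (UG scale Basis)"
      "{c, b} \<in> snd (UG scale Basis)" "{c, e} \<in> snd (UG scale Basis)"
      "{a, c} \<notin> snd (UG scale Basis)" "{b, d} \<notin> snd (UG scale Basis)" "{b, e} \<notin> snd (UG scale Basis)"
      by (rule not_chordalE)
    then have ac: "coskeleton a \<inter> coskeleton c \<noteq> {}"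
      by (auto simp: UG_edge_iff)
    have fin: "finite (coskeleton x)" for x
      using finite_subset[OF coskeleton_subset finite_Basis] .
    show False
    proof (cases "card Basis = 1")
      case True
      then obtain v where v: "Basis = {v}"
        by (auto simp: card_1_singleton_iff)
      have "a \<noteq> 0"
        using E(1) by (simp add: UG_edge_iff)
      then have "skeleton scale Basis a \<noteq> {}"
        by (simp add: skeleton_eq_empty_iff)
      \<comment> \<open>In dimension 1 a nonzero vector has full skeleton, so no two coskeletons of
        vertices can meet.\<close>
      then have "coskeleton a = {}"
        using skeleton_subset[of a] v unfolding coskeleton_def by blast
      then show ?thesis
        using ac by simp
    next
      case False
      then have "card (UNIV :: 'a set) = 2" "card Basis \<le> 3"
        using small by auto
      \<comment> \<open>Here the two-element field enters: distinct vectors have distinct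
        coskeletons, so \<open>bound\<close> applies and equal coskeletons of \<open>a\<close> and
        \<open>c\<close> are contradictory.\<close>
      then have inj: "coskeleton x \<noteq> coskeleton y" if "x \<noteq> y" for x y
        using that skeleton_inj_two_element_field[of x y] skeleton_subset[of x] skeleton_subset[of y]
        unfolding coskeleton_def by blast
      have "card (coskeleton a) \<le> 1" "card (coskeleton c) \<le> 1"
        using bound[OF E(1,2,6) ne(2) inj[OF ne(2)]] bound[OF E(3,4,7) ne(3) inj[OF ne(3)]]
          \<open>card Basis \<le> 3\<close> by linarith+
      moreover obtain x where "x \<in> coskeleton a" "x \<in> coskeleton c"
        using ac by blast
      moreover have "T = {x}" if "finite T" "card T \<le> 1" "x \<in> T" for T
        using that card_seteq[of T "{x}"] by simp
      ultimately have "coskeleton a = coskeleton c"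
        using fin by metis
      then show ?thesis
        using inj ne(1) by blast
    qed
  qed
qed

section \<open>Perfection of the skeleton graphs\<close>

lemma perfect_iff:
  assumes "finite (UNIV :: 'a set)"
  shows "perfect (IG scale Basis) \<longleftrightarrow> card Basis \<le> 4" "perfect (UG scale Basis) \<longleftrightarrow> card Basis \<le> 4"
proof -
  let ?S = "skeleton scale Basis" and ?V = "UNIV - {0 :: 'b}"
  have finV: "finite ?V"
    using finite_UNIV_vectors[OF assms] by simp
  have perfect_IG: "perfect (IG scale Basis) \<longleftrightarrow> clique_perfect (snd (IG scale Basis)) ?V"
    using perfect_iff_clique_perfect[OF _ simple_graph_IG, of scale Basis] finV by (simp add: IG_def)
  have perfect_UG: "perfect (UG scale Basis) \<longleftrightarrow> clique_perfect (snd (UG scale Basis)) ?V"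
    using perfect_iff_clique_perfect[OF _ simple_graph_UG, of scale Basis] finV by (simp add: UG_def)
  have "clique_perfect (snd (IG scale Basis)) ?V \<and> clique_perfect (snd (UG scale Basis)) ?V"
    if "card Basis \<le> 4"
  proof
    \<comment> \<open>Non-adjacency in the intersection graph is disjointness of skeletons, so
      perfection is first shown for the complement.\<close>
    have "clique_perfect (- snd (IG scale Basis)) ?V"
      by (rule clique_perfect_disjointness[OF finV finite_Basis that, of ?S])
        (auto simp: IG_edge_iff skeleton_subset[THEN subsetD])
    then show "clique_perfect (snd (IG scale Basis)) ?V"
      using clique_perfect_complement finV by fastforce
    show "clique_perfect (snd (UG scale Basis)) ?V"
      by (rule clique_perfect_disjointness[OF finV finite_Basis that, of coskeleton])
        (auto simp: UG_edge_iff coskeleton_subset[THEN subsetD])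
  qed
  moreover have "\<not> clique_perfect (snd (IG scale Basis)) ?V \<and> \<not> clique_perfect (snd (UG scale Basis)) ?V"
    if large: "\<not> card Basis \<le> 4"
  proof -
    obtain b :: "nat \<Rightarrow> 'b" where b: "inj_on b {..<5}" "b ` {..<5} \<subseteq> Basis"
      using obtain_basis_vectors[of 5] large by auto
    have b_eq: "b i = b j \<longleftrightarrow> i = j" if "i < 5" "j < 5" for i j
      using b(1) that by (auto simp: inj_on_def)
    define nxt :: "nat \<Rightarrow> nat" where "nxt i = (i + 1) mod 5" for i
    have nxt_eq: "nxt i = (if i = 4 then 0 else i + 1)" if "i < 5" for i
      using that by (auto simp: nxt_def)
    have nxt_less: "nxt i < 5" for i
      by (simp add: nxt_def)
    have nxt_inj: "nxt i = nxt j \<longleftrightarrow> i = j" and nxt_nxt: "\<not> (i = nxt j \<and> j = nxt i)"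
      if "i < 5" "j < 5" for i j
      using that nxt_eq[OF that(1)] nxt_eq[OF that(2)] by (simp_all split: if_splits)
    \<comment> \<open>These are the edges of a five-cycle on basis vectors; they form a five-cycle
      again when adjacency means sharing an end. As they are proper nonempty subsets of
      \<open>Basis\<close>, nonzero vectors realise them both as skeletons and as
      coskeletons.\<close>
    define P where "P i = {b i, b (nxt i)}" for i
    have P_sub: "P i \<subseteq> Basis" "P i \<noteq> {}" if "i < 5" for i
      using b(2) that nxt_less by (auto simp: P_def image_subset_iff)
    have P_card: "card (P i) < card Basis" for i
    proof -
      have "card (P i) \<le> 2"
        by (simp add: P_def card_insert_if)
      then show ?thesis
        using large by linarith
    qed
    then have P_psub: "P i \<subset> Basis" if "i < 5" for i
      using P_sub(1)[OF that] P_card[of i] by blast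
    have P_meet: "P i \<inter> P j \<noteq> {} \<longleftrightarrow> j = nxt i \<or> i = nxt j"
      and P_inj: "P i \<noteq> P j" if "i < 5" "j < 5" "i \<noteq> j" for i j
    proof -
      have eqs: "b i = b j \<longleftrightarrow> i = j" "b i = b (nxt j) \<longleftrightarrow> i = nxt j"
        "b (nxt i) = b j \<longleftrightarrow> nxt i = j" "b (nxt i) = b (nxt j) \<longleftrightarrow> nxt i = nxt j"
        using b_eq that nxt_less by simp_all
      show "P i \<inter> P j \<noteq> {} \<longleftrightarrow> j = nxt i \<or> i = nxt j"
        using eqs nxt_inj[OF that(1,2)] that(3) unfolding P_def by auto
      show "P i \<noteq> P j"
        using nxt_nxt[OF that(1,2)] that(3) unfolding P_def doubleton_eq_iff eqs by auto
    qed
    have "\<exists>a. ?S a = P i" if "i < 5" for i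
      using skeleton_surj[OF P_sub(1)[OF that]] by metis
    then obtain x where x: "\<And>i. i < 5 \<Longrightarrow> ?S (x i) = P i"
      by metis
    have x0: "x ` {..<5} \<subseteq> ?V"
      using x P_sub(2) skeleton_eq_empty_iff by fastforce
    have "\<exists>a. a \<noteq> 0 \<and> coskeleton a = P i" if "i < 5" for i
      using coskeleton_surj[OF P_psub[OF that]] by metis
    then obtain y where y: "\<And>i. i < 5 \<Longrightarrow> y i \<noteq> 0" "\<And>i. i < 5 \<Longrightarrow> coskeleton (y i) = P i"
      by metis
    have y0: "y ` {..<5} \<subseteq> ?V"
      using y(1) by auto
    have inj: "inj_on x {..<5}" "inj_on y {..<5}"
      using x y(2) P_inj unfolding inj_on_def by (metis lessThan_iff)+
    have "\<not> clique_colourable (snd (IG scale Basis)) (x ` {..<5})"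
    proof (rule five_cycle_not_clique_colourable(1)[folded nxt_def, OF inj(1)])
      fix i j :: nat assume ij: "i < 5" "j < 5" "i \<noteq> j"
      then have "x i \<noteq> x j"
        using inj(1) by (auto simp: inj_on_def)
      then show "{x i, x j} \<in> snd (IG scale Basis) \<longleftrightarrow> j = nxt i \<or> i = nxt j"
        unfolding IG_edge_iff x[OF ij(1)] x[OF ij(2)] P_meet[OF ij] by simp
    qed
    \<comment> \<open>In the union graph meeting coskeletons mean non-adjacency, so the five-cycle
      lies in the complement. The double complement matches the second conclusion on
      five-cycles.\<close>
    moreover have "\<not> clique_colourable (- (- snd (UG scale Basis))) (y ` {..<5})"
    proof (rule five_cycle_not_clique_colourable(2)[folded nxt_def, OF inj(2)])
      fix i j :: nat assume ij: "i < 5" "j < 5" "i \<noteq> j"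
      then have "y i \<noteq> y j"
        using inj(2) by (auto simp: inj_on_def)
      then show "{y i, y j} \<in> - snd (UG scale Basis) \<longleftrightarrow> j = nxt i \<or> i = nxt j"
        using y(1) ij unfolding P_meet[OF ij, symmetric] by (simp add: UG_edge_iff y(2))
    qed
    ultimately show ?thesis
      using x0 y0 unfolding clique_perfect_def by auto
  qed
  ultimately show "perfect (IG scale Basis) \<longleftrightarrow> card Basis \<le> 4" "perfect (UG scale Basis) \<longleftrightarrow> card Basis \<le> 4"
    unfolding perfect_IG perfect_UG by blast+
qed

end

theorem corollary4p3:
  fixes scale :: "'f::field \<Rightarrow> 'v::ab_group_add \<Rightarrow> 'v"
    and B :: "'v set"
  assumes "finite_dimensional_vector_space scale B"
    and "finite (UNIV :: 'f set)"
    and "vector_space.dim scale (UNIV :: 'v set) \<ge> 1"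
  shows
    "(chordal (IG scale B) \<longleftrightarrow> vector_space.dim scale (UNIV :: 'v set) \<le> 3) \<and>
     (chordal (UG scale B) \<longleftrightarrow>
        vector_space.dim scale (UNIV :: 'v set) = 1 \<or>
        (vector_space.dim scale (UNIV :: 'v set) \<in> {2, 3} \<and> card (UNIV :: 'f set) = 2)) \<and>
     (perfect (IG scale B) \<longleftrightarrow> perfect (UG scale B)) \<and>
     (perfect (IG scale B) \<longleftrightarrow> vector_space.dim scale (UNIV :: 'v set) \<le> 4)"
proof -
  interpret finite_dimensional_vector_space scale B
    by (rule assms(1))
  \<comment> \<open>The dimension equals \<open>card B\<close>, which turns the statements on the
    basis into statements on the dimension.\<close>
  have "card B \<ge> 1"
    using assms(3) by simp
  then show ?thesis
    unfolding dim_UNIV using IG_chordal_iff UG_chordal_iff perfect_iff assms(2) by simp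
qed

end
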